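(* Let $N\geq1$, $p>1$, $0<R\leq\infty$, let $P_1\ge0,\dots,P_N\ge0$, $|P|=P_1+\dots+P_N$, and let $V\geq0$ and $W$ be smooth functions on $(0,R)$. Suppose that $(r^{N+|P|-1}V,r^{N+|P|-1}W)$ is a $p$-Bessel pair on $(0,R)$, that is, the ODE $$\left(r^{N+|P|-1}V(r)|y'|^{p-2}y'\right)'+r^{N+|P|-1}W(r)|y|^{p-2}y=0$$ has a positive solution $\varphi$ on $(0,R)$. Then for all $u\in C_0^\infty(B_R^*\setminus\{0\})$, $$\int_{B_R^*}V(|x|)|\nabla u|^p x^P\,dx\geq\int_{B_R^*}V(|x|)\left|\frac{x}{|x|}\cdot\nabla u\right|^p x^P\,dx\geq\int_{B_R^*}W(|x|)|u|^p x^P\,dx$$ and $$\left(\int_{B_R^*}V(|x|)|\nabla u|^p x^P dx\right)^{\frac1p}\left(\int_{B_R^*}\left|\frac{\varphi'}{\varphi}\right|^pV(|x|)|u|^p x^P dx\right)^{\frac{p-1}{p}}$$ $$\geq\left(\int_{B_R^*}V(|x|)\left|\frac{x}{|x|}\cdot\nabla u\right|^p x^P dx\right)^{\frac1p}\left(\int_{B_R^*}\left|\frac{\varphi'}{\varphi}\right|^pV(|x|)|u|^p x^P dx\right)^{\frac{p-1}{p}}$$ $$\geq\frac1p\int_{B_R^*}\left[W(|x|)+(p-1)\left|\frac{\varphi'}{\varphi}\right|^pV(|x|)\right]|u|^p x^P\,dx.$$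
   Context: $x^P=|x_1|^{P_1}\cdots|x_N|^{P_N}$ is the monomial weight, $\mathbb{R}^N_*=\{(x_1,\dots,x_N)\in\mathbb{R}^N: x_i>0\text{ whenever }P_i>0\}$, $B_R=\{x\in\mathbb{R}^N:|x|<R\}$ (with $B_\infty=\mathbb{R}^N$), and $B_R^*=B_R\cap\mathbb{R}^N_*$. $C_0^\infty(B_R^*\setminus\{0\})$ is the space of real-valued smooth functions with compact support in the open set $B_R^*\setminus\{0\}$. Inside the integrals, $\frac{\varphi'}{\varphi}$ means $\frac{\varphi'(|x|)}{\varphi(|x|)}$. Solutions of the ODE are understood in the classical sense. *)

theory Defs
  imports "HOL-Analysis.Analysis"
begin

text \<open>
  Smoothness on an open set, by iterated Frechet derivatives along constant directions: all
  derivatives up to order \<open>n\<close> exist and are continuous. Only meaningful for open \<open>S\<close>.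
\<close>

fun Ck_on :: "nat \<Rightarrow> 'a::real_normed_vector set \<Rightarrow> ('a \<Rightarrow> real) \<Rightarrow> bool" where
  "Ck_on 0 S f \<longleftrightarrow> continuous_on S f"
| "Ck_on (Suc n) S f \<longleftrightarrow>
     continuous_on S f \<and> (\<forall>x\<in>S. f differentiable (at x)) \<and>
     (\<forall>v. Ck_on n S (\<lambda>x. frechet_derivative f (at x) v))"

definition smooth_on :: "'a::real_normed_vector set \<Rightarrow> ('a \<Rightarrow> real) \<Rightarrow> bool" where
  "smooth_on S f \<longleftrightarrow> (\<forall>n. Ck_on n S f)"

text \<open>Members are extended by zero to the whole space.\<close>

definition test_functions :: "'a::real_normed_vector set \<Rightarrow> ('a \<Rightarrow> real) set" where
  "test_functions S =
     {u. smooth_on S u \<and> compact (closure {x. u x \<noteq> 0}) \<and> closure {x. u x \<noteq> 0} \<subseteq> S}"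

definition grad :: "(real ^ 'n \<Rightarrow> real) \<Rightarrow> real ^ 'n \<Rightarrow> real ^ 'n" where
  "grad u x = (\<chi> i. frechet_derivative u (at x) (axis i 1))"

text \<open>
  The convention \<open>0\<^sup>0 = 1\<close> is made explicit, because \<open>0 powr 0 = 0\<close> in the library.
\<close>

definition monomial_weight :: "real ^ 'n \<Rightarrow> real ^ 'n \<Rightarrow> real" where
  "monomial_weight P x = (\<Prod>i\<in>UNIV. if P $ i = 0 then 1 else \<bar>x $ i\<bar> powr (P $ i))"

definition weight_degree :: "real ^ 'n \<Rightarrow> real" where
  "weight_degree P = (\<Sum>i\<in>UNIV. P $ i)"

definition radial_weight :: "real ^ 'n \<Rightarrow> (real \<Rightarrow> real) \<Rightarrow> real \<Rightarrow> real" where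
  "radial_weight P V r = r powr (real CARD('n) + weight_degree P - 1) * V r"

definition RN_star :: "real ^ 'n \<Rightarrow> (real ^ 'n) set" where
  "RN_star P = {x. \<forall>i. P $ i > 0 \<longrightarrow> x $ i > 0}"

text \<open>The radius is an extended real, so that \<open>R = \<infinity>\<close> gives the whole space or half-line.\<close>

definition B_star :: "real ^ 'n \<Rightarrow> ereal \<Rightarrow> (real ^ 'n) set" where
  "B_star P R = {x. ereal (norm x) < R} \<inter> RN_star P"

definition radii :: "ereal \<Rightarrow> real set" where
  "radii R = {r. 0 < r \<and> ereal r < R}"

text \<open>
  Positive classical solutions on \<open>(0, R)\<close> of
  \<open>(A |y'|\<^sup>p\<^sup>-\<^sup>2 y')' + B |y|\<^sup>p\<^sup>-\<^sup>2 y = 0\<close>: \<open>y\<close> is continuously differentiable, the flux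
  \<open>A |y'|\<^sup>p\<^sup>-\<^sup>2 y'\<close> is differentiable, and the equation holds pointwise. (No second derivative
  of \<open>y\<close> is required, as usual for \<open>p\<close>-Laplace type equations.)
  Where \<open>y' = 0\<close> the term \<open>|y'|\<^sup>p\<^sup>-\<^sup>2 y'\<close> is \<open>0\<close>, also for \<open>p < 2\<close>.
\<close>

definition p_flux :: "real \<Rightarrow> (real \<Rightarrow> real) \<Rightarrow> (real \<Rightarrow> real) \<Rightarrow> real \<Rightarrow> real" where
  "p_flux p A y r = A r * \<bar>deriv y r\<bar> powr (p - 2) * deriv y r"

definition positive_solution ::
    "real \<Rightarrow> ereal \<Rightarrow> (real \<Rightarrow> real) \<Rightarrow> (real \<Rightarrow> real) \<Rightarrow> (real \<Rightarrow> real) \<Rightarrow> bool" where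
  "positive_solution p R A B y \<longleftrightarrow>
     y C1_differentiable_on radii R \<and>
     (\<forall>r\<in>radii R. 0 < y r) \<and>
     (\<forall>r\<in>radii R. p_flux p A y differentiable (at r) \<and>
        deriv (p_flux p A y) r + B r * \<bar>y r\<bar> powr (p - 2) * y r = 0)"

definition p_Bessel_pair :: "real \<Rightarrow> ereal \<Rightarrow> (real \<Rightarrow> real) \<Rightarrow> (real \<Rightarrow> real) \<Rightarrow> bool" where
  "p_Bessel_pair p R A B \<longleftrightarrow> (\<exists>y. positive_solution p R A B y)"

end

theory Submission
  imports Defs
begin

text \<open>
  Let \<open>Q = N + |P|\<close>, \<open>A = r\<^sup>Q\<^sup>-\<^sup>1 V\<close> and \<open>B = r\<^sup>Q\<^sup>-\<^sup>1 W\<close>. For a positive solution \<open>\<phi>\<close> the quotient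
  \<open>G = A |\<phi>'|\<^sup>p\<^sup>-\<^sup>2 \<phi>' / \<phi>\<^sup>p\<^sup>-\<^sup>1\<close> satisfies the Riccati equation
  \<open>G' = - (B + (p - 1) A |\<phi>'/\<phi>|\<^sup>p)\<close> (\<open>DERIV_Riccati_quotient\<close>).

  The function \<open>|x|\<^sup>-\<^sup>Q x\<^sup>P\<close> is homogeneous of degree \<open>-N\<close>, so integration against it is invariant under
  dilations. Hence the radial derivative \<open>x \<bullet> \<nabla>h\<close> of a compactly supported function \<open>h\<close> integrates
  to zero against it (\<open>integral_radial_derivative_homogeneous_weight_eq_0\<close>). This takes the place of
  integration by parts in polar coordinates.
  For \<open>h(x) = |u|\<^sup>p G(|x|)\<close> it yields the identity (\<open>integral_Riccati_identity\<close>)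

  \<open>p \<integral> |u|\<^sup>p\<^sup>-\<^sup>2 u \<partial>\<^sub>r u |\<phi>'/\<phi>|\<^sup>p\<^sup>-\<^sup>2 (\<phi>'/\<phi>) V x\<^sup>P dx
    = \<integral> (W + (p - 1) |\<phi>'/\<phi>|\<^sup>p V) |u|\<^sup>p x\<^sup>P dx\<close>.

  Let \<open>I\<close> be the integral of \<open>V |\<partial>\<^sub>r u|\<^sup>p x\<^sup>P\<close> and \<open>J\<close> that of \<open>|\<phi>'/\<phi>|\<^sup>p V |u|\<^sup>p x\<^sup>P\<close>. Hoelder's inequality bounds
  the left side by \<open>p I\<^sup>1\<^sup>/\<^sup>p J\<^sup>(\<^sup>p\<^sup>-\<^sup>1\<^sup>)\<^sup>/\<^sup>p\<close>, which is the second chain of inequalities. Young's inequality bounds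
  it by \<open>I + (p - 1) J\<close>, and cancelling \<open>(p - 1) J\<close> leaves the Hardy inequality. The comparison of
  \<open>\<partial>\<^sub>r u\<close> with \<open>\<nabla>u\<close> is Cauchy-Schwarz. Since \<open>u\<close> has compact support in the open set where everything
  is continuous, all integrals may be taken over the whole space and converge.
\<close>

section \<open>Dilations and homogeneous weights\<close>

lemma integrable_lborel_compact_support:
  fixes f :: "'a::euclidean_space \<Rightarrow> real"
  assumes "compact K" "continuous_on K f" "\<And>x. x \<notin> K \<Longrightarrow> f x = 0"
  shows "integrable lborel f"
  by (rule Bochner_Integration.integrable_cong[THEN iffD1, OF refl _ borel_integrable_compact[OF assms(1,2)]])
    (use assms(3) in \<open>auto simp: indicator_def\<close>)

lemma integral_dilation_homogeneous_weight:
  fixes h w :: "'a::euclidean_space \<Rightarrow> real"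
  assumes [measurable]: "h \<in> borel_measurable borel" "w \<in> borel_measurable borel"
    and hom: "\<And>t x. 0 < t \<Longrightarrow> w (t *\<^sub>R x) = t powr (- real DIM('a)) * w x"
    and "0 < t"
  shows "(LINT x|lborel. h (t *\<^sub>R x) * w x) = (LINT x|lborel. h x * w x)"
proof -
  have "(LINT x|lborel. h x * w x)
      = (LINT x|density (distr lborel borel (\<lambda>x. 0 + t *\<^sub>R x)) (\<lambda>_. ennreal (\<bar>t\<bar> ^ DIM('a))). h x * w x)"
    using lborel_affine[of t "0::'a"] \<open>0 < t\<close> by (simp add: ennreal_power)
  also have "\<dots> = (LINT x|lborel. \<bar>t\<bar> ^ DIM('a) * (h (t *\<^sub>R x) * w (t *\<^sub>R x)))"
    by (subst integral_density) (auto simp: integral_distr)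
  also have "\<dots> = (LINT x|lborel. h (t *\<^sub>R x) * w x)"
  proof (rule Bochner_Integration.integral_cong[OF refl])
    fix x
    show "\<bar>t\<bar> ^ DIM('a) * (h (t *\<^sub>R x) * w (t *\<^sub>R x)) = h (t *\<^sub>R x) * w x"
      using \<open>0 < t\<close> by (simp add: hom powr_realpow powr_minus field_simps)
  qed
  finally show ?thesis by simp
qed

text \<open>By homogeneity the measure \<open>w dx\<close> is invariant under dilations, so \<open>\<integral> h(t x) w(x) dx\<close> does not
  depend on \<open>t > 0\<close>; the claim is that its derivative at \<open>t = 1\<close> vanishes. The function \<open>D\<close> is the
  radial derivative \<open>x \<bullet> \<nabla>h(x)\<close>, specified through the restrictions of \<open>h\<close> to rays. The
  statement is, formally, the divergence theorem for the field \<open>h w x\<close>: since \<open>w x\<close> is divergence free by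
  homogeneity, the divergence of the product is \<open>D w\<close>.\<close>

lemma integral_radial_derivative_homogeneous_weight_eq_0:
  fixes h D w :: "'a::euclidean_space \<Rightarrow> real"
  assumes K: "compact K" "0 \<notin> K"
    and h: "continuous_on K h" "\<And>x. x \<notin> K \<Longrightarrow> h x = 0"
    and deriv: "\<And>x s. 0 < s \<Longrightarrow> ((\<lambda>s. h (s *\<^sub>R x)) has_real_derivative D (s *\<^sub>R x) / s) (at s)"
    and D: "\<And>x. \<bar>D x\<bar> \<le> M"
    and w: "continuous_on (- {0}) w"
    and hom: "\<And>t x. 0 < t \<Longrightarrow> w (t *\<^sub>R x) = t powr (- real DIM('a)) * w x"
  shows "(LINT x|lborel. D x * w x) = 0"
proof -
  define t where "t n = 1 + 1 / real (Suc n)" for n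
  define q where "q n x = (h (t n *\<^sub>R x) - h x) / (t n - 1)" for n x
  have t: "1 < t n" "t n \<le> 2" for n
    by (auto simp: t_def divide_simps)
  have t_lim: "t \<longlonglongrightarrow> 1"
    unfolding t_def by (rule tendsto_eq_intros LIMSEQ_inverse_real_of_nat[unfolded inverse_eq_divide] | simp)+
  have [measurable]: "w \<in> borel_measurable borel"
    by (rule borel_measurable_continuous_countable_exceptions[OF _ w]) auto
  have hK: "h = (\<lambda>x. indicator K x *\<^sub>R h x)"
    using h(2) by (intro ext) (auto simp: indicator_def)
  have [measurable]: "h \<in> borel_measurable borel"
    by (subst hK) (intro borel_measurable_continuous_on_indicator compact_imp_closed borel_closed K h)
  have q_meas [measurable]: "q n \<in> borel_measurable borel" for n
    unfolding q_def by measurable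
  have q_lim: "(\<lambda>n. q n x) \<longlonglongrightarrow> D x" for x
  proof -
    have "((\<lambda>s. (h (s *\<^sub>R x) - h x) / (s - 1)) \<longlongrightarrow> D x) (at 1)"
      using deriv[of 1 x] by (simp add: has_field_derivative_iff)
    moreover have "filterlim t (at 1) sequentially"
      using t t_lim by (auto simp: filterlim_at intro!: always_eventually) (metis less_irrefl)
    ultimately show ?thesis unfolding q_def by (rule filterlim_compose)
  qed
  have D_meas [measurable]: "D \<in> borel_measurable borel"
    by (rule borel_measurable_LIMSEQ_real[OF q_lim]) auto
  define A where "A = (\<lambda>(s, y). s *\<^sub>R y) ` ({1/2..1} \<times> K)"
  \<comment> \<open>\<open>t n\<close> lies in \<open>{1..2}\<close>, so the rescaled supports stay in one compact set that avoids the origin,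
    where \<open>w\<close> is bounded; this yields an integrable dominating function.\<close>
  have A: "compact A"
    unfolding A_def by (intro compact_continuous_image compact_Times K)
      (auto simp: case_prod_beta intro!: continuous_intros)
  have "0 \<notin> A" using K by (auto simp: A_def)
  have A_I: "s *\<^sub>R y \<in> A" if "1 / 2 \<le> s" "s \<le> 1" "y \<in> K" for s y
    unfolding A_def using that by (intro image_eqI[where x = "(s, y)"]) auto
  have q_supp: "q n x = 0" if "x \<notin> A" for n x
  proof -
    have "x \<notin> K" using A_I[of 1 x] that by auto
    moreover have "t n *\<^sub>R x \<notin> K"
      using A_I[of "1 / t n" "t n *\<^sub>R x"] t[of n] that by (auto simp: field_simps)
    ultimately show ?thesis by (simp add: q_def h)
  qed
  have q_bd: "\<bar>q n x\<bar> \<le> M" for n x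
  proof -
    obtain s where s: "1 < s" "s < t n" "h (t n *\<^sub>R x) - h (1 *\<^sub>R x) = (t n - 1) * (D (s *\<^sub>R x) / s)"
      using MVT2[OF t(1)[of n], of "\<lambda>s. h (s *\<^sub>R x)" "\<lambda>s. D (s *\<^sub>R x) / s"] deriv by auto
    then have "q n x = D (s *\<^sub>R x) / s" using t(1)[of n] by (simp add: q_def)
    also have "\<bar>\<dots>\<bar> \<le> \<bar>D (s *\<^sub>R x)\<bar> / 1"
      unfolding abs_divide using s by (intro divide_left_mono) auto
    finally show ?thesis using D[of "s *\<^sub>R x"] by simp
  qed
  have wA: "continuous_on A (\<lambda>x. M * \<bar>w x\<bar>)"
    using \<open>0 \<notin> A\<close> by (intro continuous_intros continuous_on_subset[OF w]) auto
  have dom: "integrable lborel (\<lambda>x. indicator A x *\<^sub>R (M * \<bar>w x\<bar>))"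
    by (rule borel_integrable_compact[OF A wA])
  have q_le: "norm (q n x * w x) \<le> indicator A x *\<^sub>R (M * \<bar>w x\<bar>)" for n x
    using q_supp[of x n] q_bd[of n x]
    by (cases "x \<in> A") (auto simp: abs_mult intro!: mult_right_mono)
  have q_lim': "(\<lambda>n. q n x * w x) \<longlonglongrightarrow> D x * w x" for x
    by (intro tendsto_intros q_lim)
  have lim: "(\<lambda>n. LINT x|lborel. q n x * w x) \<longlonglongrightarrow> (LINT x|lborel. D x * w x)"
    by (rule integral_dominated_convergence[OF _ _ dom])
       (use q_lim' q_le in auto)
  have "(LINT x|lborel. q n x * w x) = 0" for n
  proof -
    have "continuous_on K (\<lambda>x. h x * w x)"
      using K by (intro continuous_intros h continuous_on_subset[OF w]) auto
    then have hw: "integrable lborel (\<lambda>x. h x * w x)"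
      using h(2) by (intro integrable_lborel_compact_support[OF K(1)]) auto
    have qw: "integrable lborel (\<lambda>x. q n x * w x)"
      by (rule Bochner_Integration.integrable_bound[OF dom]) (use q_le in \<open>auto intro!: AE_I2 order_trans[OF _ abs_ge_self]\<close>)
    have "(LINT x|lborel. h x * w x) = (LINT x|lborel. h (t n *\<^sub>R x) * w x)"
      by (rule integral_dilation_homogeneous_weight[symmetric]) (use t(1)[of n] hom in auto)
    also have "\<dots> = (LINT x|lborel. (t n - 1) * (q n x * w x) + h x * w x)"
      using t(1)[of n] by (intro Bochner_Integration.integral_cong) (auto simp: q_def field_simps)
    also have "\<dots> = (t n - 1) * (LINT x|lborel. q n x * w x) + (LINT x|lborel. h x * w x)"
      using hw qw by simp
    finally show ?thesis using t(1)[of n] by simp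
  qed
  with lim show ?thesis by (simp add: LIMSEQ_const_iff)
qed

section \<open>Young and Hoelder inequalities\<close>

lemma weighted_AM_GM:
  fixes x y :: real
  assumes "0 \<le> x" "0 \<le> y" "0 < a" "0 < b" "a + b = 1"
  shows "x powr a * y powr b \<le> a * x + b * y"
proof (cases "x = 0 \<or> y = 0")
  case False
  then show ?thesis using Youngs_inequality_0[of a b x y] assms by simp
qed (use assms in auto)

text \<open>Hoelder's inequality for the exponents \<open>1/a\<close> and \<open>1/b\<close>: if both integrals are positive, normalise
  them to \<open>1\<close> and integrate the weighted AM-GM inequality; if one vanishes, the product vanishes
  almost everywhere.\<close>

lemma Holder_inequality_powr:
  fixes f g :: "'a \<Rightarrow> real"
  assumes f: "integrable M f" "\<And>x. 0 \<le> f x"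
    and g: "integrable M g" "\<And>x. 0 \<le> g x"
    and ab: "0 < a" "0 < b" "a + b = 1"
  shows "(LINT x|M. f x powr a * g x powr b) \<le> (LINT x|M. f x) powr a * (LINT x|M. g x) powr b"
proof -
  note [measurable] = borel_measurable_integrable[OF f(1)] borel_measurable_integrable[OF g(1)]
  define F G where "F = (LINT x|M. f x)" and "G = (LINT x|M. g x)"
  have "0 \<le> F" "0 \<le> G" using f g by (auto simp: F_def G_def)
  consider "F = 0" | "G = 0" | "0 < F" "0 < G"
    using \<open>0 \<le> F\<close> \<open>0 \<le> G\<close> by linarith
  then show ?thesis
  proof cases
    case 1
    then have "AE x in M. f x = 0"
      using integral_nonneg_eq_0_iff_AE[OF f(1)] f(2) by (simp add: F_def)
    then have "(LINT x|M. f x powr a * g x powr b) = 0"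
      by (intro integral_eq_zero_AE) auto
    then show ?thesis by simp
  next
    case 2
    then have "AE x in M. g x = 0"
      using integral_nonneg_eq_0_iff_AE[OF g(1)] g(2) by (simp add: G_def)
    then have "(LINT x|M. f x powr a * g x powr b) = 0"
      by (intro integral_eq_zero_AE) auto
    then show ?thesis by simp
  next
    case 3
    have le: "f x powr a * g x powr b \<le> (F powr a * G powr b) * (a * (f x / F) + b * (g x / G))" for x
    proof -
      have "(f x / F) powr a * (g x / G) powr b \<le> a * (f x / F) + b * (g x / G)"
        using 3 f g ab by (intro weighted_AM_GM) auto
      then show ?thesis
        using 3 f g by (simp add: powr_divide field_simps)
    qed
    have "(LINT x|M. f x powr a * g x powr b)
        \<le> (LINT x|M. (F powr a * G powr b) * (a * (f x / F) + b * (g x / G)))"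
    proof (rule Bochner_Integration.integral_mono[OF _ _ le])
      show int: "integrable M (\<lambda>x. (F powr a * G powr b) * (a * (f x / F) + b * (g x / G)))"
        using f g by simp
      show "integrable M (\<lambda>x. f x powr a * g x powr b)"
        by (rule Bochner_Integration.integrable_bound[OF int]) (use le in \<open>auto intro!: AE_I2 order_trans[OF _ abs_ge_self]\<close>)
    qed
    also have "\<dots> = (F powr a * G powr b) * (a * (F / F) + b * (G / G))"
      using f g by (simp add: F_def G_def)
    also have "\<dots> = F powr a * G powr b" using 3 ab by simp
    finally show ?thesis unfolding F_def G_def .
  qed
qed

lemma set_integral_eq_integral_of_support:
  fixes f :: "'a \<Rightarrow> real"
  assumes "\<And>x. x \<notin> S \<Longrightarrow> f x = 0"
  shows "(LINT x:S|M. f x) = (LINT x|M. f x)"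
  unfolding set_lebesgue_integral_def
  by (rule Bochner_Integration.integral_cong) (use assms in \<open>auto simp: indicator_def\<close>)

section \<open>Test functions\<close>

lemma has_derivative_0_outside_support:
  fixes u :: "'a::real_normed_vector \<Rightarrow> real"
  assumes "x \<notin> closure {x. u x \<noteq> 0}"
  shows "(u has_derivative (\<lambda>_. 0)) (at x)"
proof (rule has_derivative_transform_within_open[of "\<lambda>_. 0" _ _ _ "- closure {x. u x \<noteq> 0}"])
  show "\<And>y. y \<in> - closure {x. u x \<noteq> 0} \<Longrightarrow> 0 = u y"
    by (metis (mono_tags) ComplD closure_subset mem_Collect_eq subsetD)
qed (use assms in auto)

text \<open>This holds at every point, not only in \<open>S\<close>: off its support \<open>u\<close> is locally zero.\<close>

lemma test_function_has_derivative_grad: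
  fixes u :: "real ^ 'n \<Rightarrow> real"
  assumes "u \<in> test_functions S"
  shows "(u has_derivative (\<lambda>v. v \<bullet> grad u x)) (at x)"
proof -
  have "u differentiable (at x)"
  proof (cases "x \<in> S")
    case True
    have "Ck_on (Suc 0) S u" using assms by (auto simp: test_functions_def smooth_on_def)
    then show ?thesis using True by simp
  next
    case False
    then have "x \<notin> closure {x. u x \<noteq> 0}" using assms by (auto simp: test_functions_def)
    then show ?thesis by (rule differentiableI[OF has_derivative_0_outside_support])
  qed
  then have d: "(u has_derivative frechet_derivative u (at x)) (at x)"
    by (simp add: frechet_derivative_works)
  have "frechet_derivative u (at x) v = v \<bullet> grad u x" for v
  proof -
    interpret linear "frechet_derivative u (at x)" using d by (rule has_derivative_linear)
    have "frechet_derivative u (at x) v = frechet_derivative u (at x) (\<Sum>i\<in>UNIV. v $ i *\<^sub>R axis i 1)"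
      by (simp add: basis_expansion scalar_mult_eq_scaleR[symmetric])
    also have "\<dots> = v \<bullet> grad u x"
      by (simp add: sum scale inner_vec_def grad_def)
    finally show ?thesis .
  qed
  then show ?thesis using d by (metis (no_types, lifting) ext)
qed

lemma test_function_continuous_grad:
  fixes u :: "real ^ 'n \<Rightarrow> real"
  assumes "u \<in> test_functions S"
  shows "continuous_on S (grad u)"
proof -
  have "Ck_on (Suc 0) S u" using assms by (auto simp: test_functions_def smooth_on_def)
  then show ?thesis
    unfolding grad_def by (intro continuous_on_vec_lambda) auto
qed

lemma grad_eq_0_outside_support:
  assumes "x \<notin> closure {x. u x \<noteq> 0}"
  shows "grad u x = 0"
  using frechet_derivative_at[OF has_derivative_0_outside_support[OF assms]]
  by (simp add: grad_def vec_eq_iff fun_eq_iff)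

section \<open>Signed powers\<close>

lemma DERIV_abs_powr:
  fixes x p :: real
  assumes "1 < p"
  shows "((\<lambda>x. \<bar>x\<bar> powr p) has_real_derivative p * \<bar>x\<bar> powr (p - 1) * sgn x) (at x)"
proof -
  consider "x = 0" | "0 < x" | "x < 0" by linarith
  then show ?thesis
  proof cases
    case 1
    have "((\<lambda>h. \<bar>h\<bar> powr (p - 1)) \<longlongrightarrow> \<bar>0\<bar> powr (p - 1)) (at (0::real))"
      using assms by (intro tendsto_powr' tendsto_intros) auto
    then have "((\<lambda>h. \<bar>h\<bar> powr (p - 1)) \<longlongrightarrow> 0) (at (0::real))" by simp
    moreover have "\<forall>\<^sub>F h in at (0::real). \<bar>h\<bar> powr (p - 1) = \<bar>\<bar>h\<bar> powr p / h\<bar>"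
      by (auto simp: eventually_at_filter powr_diff)
    ultimately have "((\<lambda>h. \<bar>\<bar>h\<bar> powr p / h\<bar>) \<longlongrightarrow> 0) (at (0::real))"
      by (rule Lim_transform_eventually)
    then have "((\<lambda>h. \<bar>h\<bar> powr p / h) \<longlongrightarrow> 0) (at (0::real))"
      by (rule tendsto_rabs_zero_cancel)
    then show ?thesis using 1 by (simp add: has_field_derivative_iff)
  next
    case 2
    have "((\<lambda>x. x powr p) has_real_derivative p * x powr (p - 1)) (at x)"
      using 2 by (rule has_real_derivative_powr)
    then have "((\<lambda>x. \<bar>x\<bar> powr p) has_real_derivative p * x powr (p - 1)) (at x)"
      by (rule has_field_derivative_transform_within_open[where S = "{0<..}"]) (use 2 in auto)
    then show ?thesis using 2 by simp
  next
    case 3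
    have "((\<lambda>x. (- x) powr p) has_real_derivative p * (- x) powr (p - 1) * (- 1)) (at x)"
      using 3 by (intro DERIV_chain2[OF has_real_derivative_powr]) (auto intro!: derivative_eq_intros)
    then have "((\<lambda>x. \<bar>x\<bar> powr p) has_real_derivative p * (- x) powr (p - 1) * (- 1)) (at x)"
      by (rule has_field_derivative_transform_within_open[where S = "{..<0}"]) (use 3 in auto)
    then show ?thesis using 3 by simp
  qed
qed

text \<open>The sign jumps where \<open>f\<close> vanishes; writing the signed power as a difference of powers of the positive
  and the negative part shows that the product does not.\<close>

lemma continuous_on_abs_powr_sgn:
  fixes f :: "'a::topological_space \<Rightarrow> real"
  assumes "continuous_on S f" "0 < q"
  shows "continuous_on S (\<lambda>x. \<bar>f x\<bar> powr q * sgn (f x))"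
proof -
  have "(\<lambda>x. \<bar>f x\<bar> powr q * sgn (f x)) = (\<lambda>x. max (f x) 0 powr q - max (- f x) 0 powr q)"
    using assms(2) by (auto simp: fun_eq_iff sgn_if)
  then show ?thesis
    using assms
    by (simp only:) (intro continuous_on_diff continuous_on_powr' continuous_on_max
        continuous_on_minus continuous_on_const; simp)
qed

lemma continuous_on_abs_powr:
  fixes f :: "'a::topological_space \<Rightarrow> real"
  assumes "continuous_on S f" "0 < q"
  shows "continuous_on S (\<lambda>x. \<bar>f x\<bar> powr q)"
  using assms by (intro continuous_on_powr' continuous_on_rabs continuous_on_const; simp)

section \<open>The monomial weight and its domain\<close>

lemma continuous_on_monomial_weight:
  fixes P :: "real ^ 'n"
  assumes "\<forall>i. 0 \<le> P $ i"
  shows "continuous_on S (monomial_weight P)"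
  unfolding monomial_weight_def
proof (intro continuous_on_prod)
  fix i :: 'n
  show "continuous_on S (\<lambda>x. if P $ i = 0 then 1 else \<bar>x $ i\<bar> powr P $ i)"
    using assms[rule_format, of i]
    by (cases "P $ i = 0") (auto intro!: continuous_on_abs_powr continuous_intros)
qed

lemma monomial_weight_nonneg: "0 \<le> monomial_weight P x"
  unfolding monomial_weight_def by (intro prod_nonneg) auto

lemma monomial_weight_scaleR:
  assumes "0 < t"
  shows "monomial_weight P (t *\<^sub>R x) = t powr weight_degree P * monomial_weight P x"
proof -
  have "t powr weight_degree P = (\<Prod>i\<in>UNIV. t powr P $ i)"
    using assms by (simp add: weight_degree_def powr_sum)
  then show ?thesis
    unfolding monomial_weight_def using assms
    by (auto simp: prod.distrib[symmetric] abs_mult powr_mult intro!: prod.cong)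
qed

lemma norm_in_radii: "x \<in> B_star P R - {0} \<Longrightarrow> norm x \<in> radii R"
  by (auto simp: B_star_def radii_def)

section \<open>The Riccati equation of a positive solution\<close>

lemma positive_solution_facts:
  assumes "positive_solution p R A B \<phi>" "r \<in> radii R"
  shows "0 < \<phi> r" "(\<phi> has_real_derivative deriv \<phi> r) (at r)"
    "(p_flux p A \<phi> has_real_derivative - (B r * \<phi> r powr (p - 1))) (at r)"
proof -
  show pos: "0 < \<phi> r" using assms by (auto simp: positive_solution_def)
  obtain D where "(\<phi> has_real_derivative D) (at r)"
    using assms by (auto simp: positive_solution_def C1_differentiable_on_def
        has_real_derivative_iff_has_vector_derivative)
  then show "(\<phi> has_real_derivative deriv \<phi> r) (at r)"
    using DERIV_imp_deriv by blast
  have "p_flux p A \<phi> differentiable (at r)"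
    using assms by (auto simp: positive_solution_def)
  then obtain F where F: "(p_flux p A \<phi> has_real_derivative F) (at r)"
    by (auto simp: real_differentiable_def)
  have "deriv (p_flux p A \<phi>) r + B r * \<bar>\<phi> r\<bar> powr (p - 2) * \<phi> r = 0"
    using assms by (auto simp: positive_solution_def)
  moreover have "\<bar>\<phi> r\<bar> powr (p - 2) * \<phi> r = \<phi> r powr (p - 1)"
    using pos powr_add[of "\<phi> r" "p - 2" 1] by simp
  ultimately have "F = - (B r * \<phi> r powr (p - 1))"
    using DERIV_imp_deriv[OF F] by (simp add: mult.assoc)
  with F show "(p_flux p A \<phi> has_real_derivative - (B r * \<phi> r powr (p - 1))) (at r)" by simp
qed

lemma continuous_on_deriv_positive_solution:
  assumes "positive_solution p R A B \<phi>"
  shows "continuous_on (radii R) (deriv \<phi>)"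
proof -
  obtain D where D: "\<And>r. r \<in> radii R \<Longrightarrow> (\<phi> has_real_derivative D r) (at r)" "continuous_on (radii R) D"
    using assms by (auto simp: positive_solution_def C1_differentiable_on_def
        has_real_derivative_iff_has_vector_derivative)
  then show ?thesis
    using DERIV_imp_deriv by (metis continuous_on_cong)
qed

text \<open>Dividing the flux by \<open>\<phi>\<^sup>p\<^sup>-\<^sup>1\<close> turns the second-order equation into a Riccati equation of first order
  for the quotient. Its derivative involves \<open>\<phi>'\<close> but no second derivative, and it produces exactly the
  weight \<open>B + (p - 1) A |\<phi>'/\<phi>|\<^sup>p\<close> of the final inequality.\<close>

lemma DERIV_Riccati_quotient:
  assumes sol: "positive_solution p R A B \<phi>" and r: "r \<in> radii R"
  shows "((\<lambda>r. p_flux p A \<phi> r / \<phi> r powr (p - 1)) has_real_derivative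
    - (B r + (p - 1) * A r * \<bar>deriv \<phi> r / \<phi> r\<bar> powr p)) (at r)"
proof -
  note f = positive_solution_facts[OF sol r]
  let ?d = "deriv \<phi> r"
  have d: "((\<lambda>r. \<phi> r powr (p - 1)) has_real_derivative (p - 1) * \<phi> r powr (p - 2) * ?d) (at r)"
    using DERIV_chain2[OF has_real_derivative_powr[OF f(1)] f(2), of "p - 1"] by simp
  have flux: "p_flux p A \<phi> r * ?d = A r * \<bar>?d\<bar> powr p"
  proof (cases "?d = 0")
    case False
    have "\<bar>?d\<bar> powr p = \<bar>?d\<bar> powr (p - 2) * (?d * ?d)"
      using powr_add[of "\<bar>?d\<bar>" "p - 2" 2] False by (simp add: power2_eq_square)
    then show ?thesis by (simp add: p_flux_def)
  qed (simp add: p_flux_def)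
  have q: "\<phi> r powr (p - 2) / (\<phi> r powr (p - 1) * \<phi> r powr (p - 1)) = 1 / \<phi> r powr p"
    using f(1) by (simp add: powr_add[symmetric] powr_diff[symmetric] powr_minus_divide[symmetric])
  have "((\<lambda>r. p_flux p A \<phi> r / \<phi> r powr (p - 1)) has_real_derivative
    (- (B r * \<phi> r powr (p - 1)) * \<phi> r powr (p - 1)
      - p_flux p A \<phi> r * ((p - 1) * \<phi> r powr (p - 2) * ?d)) / (\<phi> r powr (p - 1) * \<phi> r powr (p - 1))) (at r)"
    using DERIV_divide[OF f(3) d] f(1) by simp
  also have "(- (B r * \<phi> r powr (p - 1)) * \<phi> r powr (p - 1)
      - p_flux p A \<phi> r * ((p - 1) * \<phi> r powr (p - 2) * ?d)) / (\<phi> r powr (p - 1) * \<phi> r powr (p - 1))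
     = - B r - (p - 1) * (p_flux p A \<phi> r * ?d) * (\<phi> r powr (p - 2) / (\<phi> r powr (p - 1) * \<phi> r powr (p - 1)))"
    using f(1) by (simp add: field_simps)
  also have "\<dots> = - (B r + (p - 1) * A r * \<bar>?d / \<phi> r\<bar> powr p)"
    using f(1) unfolding q flux by (simp add: powr_divide abs_divide)
  finally show ?thesis .
qed

section \<open>The integral identity\<close>

lemma continuous_on_radial:
  assumes "continuous_on (radii R) f" "K \<subseteq> B_star P R - {0}"
  shows "continuous_on K (\<lambda>x. f (norm x))"
  using assms(2) by (intro continuous_on_compose2[OF assms(1)] continuous_intros) (auto intro: norm_in_radii)

lemma continuous_on_radial_weight:
  assumes "continuous_on (radii R) V"
  shows "continuous_on (radii R) (radial_weight P V)"
  unfolding radial_weight_def using assms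
  by (intro continuous_intros) (auto simp: radii_def)

text \<open>
  The core of the argument: the dilation lemma applied to \<open>h(x) = |u|\<^sup>p G(|x|)\<close>, where \<open>G\<close> is the
  Riccati quotient, and to \<open>w(x) = |x|\<^sup>-\<^sup>Q x\<^sup>P\<close> with \<open>Q = N + |P|\<close>, which is homogeneous of degree \<open>-N\<close>.
  The product rule splits the radial derivative of \<open>h\<close>, multiplied by \<open>w\<close>, into a part with
  \<open>\<partial>\<^sub>r u\<close>, which is \<open>p T\<close>, and a part with \<open>G'\<close>, which is \<open>- S\<close> by the Riccati equation; the factor \<open>r\<^sup>Q\<^sup>-\<^sup>1\<close> inside the radial weights
  cancels the power of \<open>|x|\<close> in \<open>w\<close>.\<close>

lemma integral_Riccati_identity:
  fixes P :: "real ^ 'n"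
  assumes p: "1 < p" and P: "\<forall>i. 0 \<le> P $ i"
    and V: "continuous_on (radii R) V" and W: "continuous_on (radii R) W"
    and sol: "positive_solution p R (radial_weight P V) (radial_weight P W) \<phi>"
    and u: "u \<in> test_functions (B_star P R - {0})"
  defines "T \<equiv> \<lambda>x. \<bar>u x\<bar> powr (p - 1) * sgn (u x) * ((x /\<^sub>R norm x) \<bullet> grad u x)
      * (V (norm x) * \<bar>deriv \<phi> (norm x)\<bar> powr (p - 2) * deriv \<phi> (norm x) / \<phi> (norm x) powr (p - 1))
      * monomial_weight P x"
    and "S \<equiv> \<lambda>x. (W (norm x) + (p - 1) * \<bar>deriv \<phi> (norm x) / \<phi> (norm x)\<bar> powr p * V (norm x))
      * \<bar>u x\<bar> powr p * monomial_weight P x"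
  shows "integrable lborel T" "integrable lborel S"
    "p * (LINT x|lborel. T x) = (LINT x|lborel. S x)"
proof -
  define K where "K = closure {x. u x \<noteq> 0}"
  have K: "compact K" "closed K" "K \<subseteq> B_star P R - {0}"
    using u by (auto simp: K_def test_functions_def)
  then have "0 \<notin> K" by auto
  have u0: "u x = 0" if "x \<notin> K" for x
    using that closure_subset[of "{x. u x \<noteq> 0}"] by (auto simp: K_def)
  have du: "(u has_derivative (\<lambda>v. v \<bullet> grad u x)) (at x)" for x
    by (rule test_function_has_derivative_grad[OF u])
  define A where "A = radial_weight P V"
  define B where "B = radial_weight P W"
  define Q where "Q = real CARD('n) + weight_degree P"
  define G where "G r = p_flux p A \<phi> r / \<phi> r powr (p - 1)" for r
  define G' where "G' r = - (B r + (p - 1) * A r * \<bar>deriv \<phi> r / \<phi> r\<bar> powr p)" for r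
  define h where "h x = \<bar>u x\<bar> powr p * G (norm x)" for x
  define D where "D x = p * (\<bar>u x\<bar> powr (p - 1) * sgn (u x)) * (x \<bullet> grad u x) * G (norm x)
      + \<bar>u x\<bar> powr p * G' (norm x) * norm x" for x
  define w where "w x = norm x powr (- Q) * monomial_weight P x" for x
  have sol': "positive_solution p R A B \<phi>" using sol by (simp add: A_def B_def)
  note sf = positive_solution_facts[OF sol']
  have pos: "0 < \<phi> (norm x)" "0 < norm x" if "x \<in> K" for x
    using that K sf(1) norm_in_radii[of x P R] by auto
  have dG: "(G has_real_derivative G' r) (at r)" if "r \<in> radii R" for r
    using DERIV_Riccati_quotient[OF sol' that] by (simp add: G_def[abs_def] G'_def)
  have c\<phi>: "continuous_on (radii R) \<phi>"
    using sf(2) by (meson DERIV_isCont continuous_at_imp_continuous_on)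
  have cd\<phi>: "continuous_on (radii R) (deriv \<phi>)"
    by (rule continuous_on_deriv_positive_solution[OF sol'])
  have cG: "continuous_on (radii R) G"
    using dG by (meson DERIV_isCont continuous_at_imp_continuous_on)
  have cq: "continuous_on (radii R) (\<lambda>r. \<bar>deriv \<phi> r / \<phi> r\<bar> powr p)"
    using p sf(1) by (intro continuous_on_abs_powr continuous_on_divide cd\<phi> c\<phi>)
      (auto dest!: sf(1))
  have cG': "continuous_on (radii R) G'"
    unfolding G'_def A_def B_def by (intro continuous_intros continuous_on_radial_weight V W cq)
  note rad = continuous_on_radial[OF _ K(3)]
  have cu: "continuous_on K u"
    using du by (meson continuous_at_imp_continuous_on has_derivative_continuous)
  have cgrad: "continuous_on K (grad u)"
    using test_function_continuous_grad[OF u] K(3) continuous_on_subset by blast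
  have ch: "continuous_on K h"
    unfolding h_def using p by (intro continuous_intros continuous_on_abs_powr cu rad cG) auto
  have cD: "continuous_on K D"
    unfolding D_def using p
    by (intro continuous_on_add continuous_on_mult continuous_on_inner continuous_on_const continuous_on_id
        continuous_on_norm continuous_on_abs_powr continuous_on_abs_powr_sgn cu cgrad rad cG cG') auto
  have D0: "D x = 0" if "x \<notin> K" for x
    using u0[OF that] by (simp add: D_def)
  obtain M where M: "\<bar>D x\<bar> \<le> M" for x
  proof -
    obtain M where "\<forall>y\<in>D ` K. norm y \<le> M"
      using compact_imp_bounded[OF compact_continuous_image[OF cD K(1)]] by (auto simp: bounded_iff)
    then have "\<bar>D x\<bar> \<le> max M 0" for x
      by (cases "x \<in> K") (auto simp: D0)
    then show thesis by (rule that)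
  qed
  have cw: "continuous_on (- {0}) w"
    unfolding w_def by (intro continuous_intros continuous_on_monomial_weight P) auto
  have hom: "w (t *\<^sub>R x) = t powr (- real DIM(real^'n)) * w x" if "0 < t" for t x
    using that by (simp add: w_def monomial_weight_scaleR powr_mult powr_add[symmetric] Q_def)
  \<comment> \<open>Off the support of \<open>u\<close>, where \<open>G\<close> may fail to be differentiable, \<open>h\<close> vanishes on an open piece
    of the ray.\<close>
  have deriv_h: "((\<lambda>s. h (s *\<^sub>R x)) has_real_derivative D (s *\<^sub>R x) / s) (at s)"
    if s: "0 < s" for x s
  proof (cases "s *\<^sub>R x \<in> K")
    case True
    then have r: "s * norm x \<in> radii R"
      using norm_in_radii[OF subsetD[OF K(3) True]] s by simp
    have "((\<lambda>s. u (s *\<^sub>R x)) has_derivative (\<lambda>t. (t *\<^sub>R x) \<bullet> grad u (s *\<^sub>R x))) (at s)"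
      by (rule has_derivative_compose[OF _ du]) (auto intro!: derivative_eq_intros)
    then have "((\<lambda>s. u (s *\<^sub>R x)) has_real_derivative x \<bullet> grad u (s *\<^sub>R x)) (at s)"
      by (rule has_derivative_imp_has_field_derivative) simp
    from DERIV_chain2[OF DERIV_abs_powr[OF p] this]
    have "((\<lambda>s. \<bar>u (s *\<^sub>R x)\<bar> powr p) has_real_derivative
        p * \<bar>u (s *\<^sub>R x)\<bar> powr (p - 1) * sgn (u (s *\<^sub>R x)) * (x \<bullet> grad u (s *\<^sub>R x))) (at s)" .
    moreover have "((\<lambda>s. G (s * norm x)) has_real_derivative G' (s * norm x) * norm x) (at s)"
      by (rule DERIV_chain2[where f = G and g = "\<lambda>s. s * norm x", OF dG[OF r]]) (auto intro!: derivative_eq_intros)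
    ultimately have "((\<lambda>s. \<bar>u (s *\<^sub>R x)\<bar> powr p * G (s * norm x)) has_real_derivative
        p * \<bar>u (s *\<^sub>R x)\<bar> powr (p - 1) * sgn (u (s *\<^sub>R x)) * (x \<bullet> grad u (s *\<^sub>R x)) * G (s * norm x)
        + G' (s * norm x) * norm x * \<bar>u (s *\<^sub>R x)\<bar> powr p) (at s)"
      by (rule DERIV_mult)
    also have "p * \<bar>u (s *\<^sub>R x)\<bar> powr (p - 1) * sgn (u (s *\<^sub>R x)) * (x \<bullet> grad u (s *\<^sub>R x)) * G (s * norm x)
        + G' (s * norm x) * norm x * \<bar>u (s *\<^sub>R x)\<bar> powr p = D (s *\<^sub>R x) / s"
      using s by (simp add: D_def field_simps)
    finally have "((\<lambda>s. \<bar>u (s *\<^sub>R x)\<bar> powr p * G (s * norm x)) has_real_derivative D (s *\<^sub>R x) / s) (at s)" .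
    then show ?thesis
      by (rule has_field_derivative_transform_within_open[where S = "{0<..}"]) (use s in \<open>auto simp: h_def\<close>)
  next
    case False
    have "open ((\<lambda>s. s *\<^sub>R x) -` (- K))"
      using K(2) by (intro open_vimage continuous_intros) auto
    then have "((\<lambda>s. h (s *\<^sub>R x)) has_real_derivative 0) (at s)"
      by (rule has_field_derivative_transform_within_open[OF DERIV_const[of 0]])
        (use False u0 in \<open>auto simp: h_def\<close>)
    then show ?thesis using D0[OF False] by simp
  qed
  have zero: "(LINT x|lborel. D x * w x) = 0"
    by (rule integral_radial_derivative_homogeneous_weight_eq_0[OF K(1) \<open>0 \<notin> K\<close> ch _ deriv_h M cw hom])
      (auto simp: h_def u0)
  \<comment> \<open>The factor \<open>norm x\<close> turns the derivative along \<open>x\<close> into the one along \<open>x / norm x\<close>.\<close>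
  have split: "D x * w x = p * T x - S x" for x
  proof (cases "x \<in> K")
    case True
    have x: "norm x powr (Q - 1) * norm x powr (- Q) * norm x = 1"
    proof -
      have "norm x powr (Q - 1) * norm x powr (- Q) * norm x powr 1 = norm x powr 0"
        by (simp only: powr_add[symmetric]) simp
      then show ?thesis using pos(2)[OF True] by simp
    qed
    have GT: "T x = (\<bar>u x\<bar> powr (p - 1) * sgn (u x)) * (x \<bullet> grad u x) * G (norm x) * w x"
    proof -
      have "T x = norm x powr (Q - 1) * norm x powr (- Q) * norm x * T x" using x by simp
      also have "\<dots> = (\<bar>u x\<bar> powr (p - 1) * sgn (u x)) * (x \<bullet> grad u x) * G (norm x) * w x"
        using pos[OF True]
        by (simp add: T_def G_def p_flux_def A_def radial_weight_def w_def Q_def field_simps)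
      finally show ?thesis .
    qed
    have GS: "S x = - (\<bar>u x\<bar> powr p * G' (norm x) * norm x * w x)"
    proof -
      have "S x = norm x powr (Q - 1) * norm x powr (- Q) * norm x * S x" using x by simp
      also have "\<dots> = - (\<bar>u x\<bar> powr p * G' (norm x) * norm x * w x)"
        by (simp add: S_def G'_def A_def B_def radial_weight_def w_def Q_def algebra_simps)
      finally show ?thesis .
    qed
    show ?thesis unfolding GT GS D_def by (simp add: algebra_simps)
  next
    case False
    then show ?thesis using u0[OF False] by (simp add: D0 T_def S_def)
  qed
  have "integrable lborel (\<lambda>x. D x * w x)"
    using cD K \<open>0 \<notin> K\<close>
    by (intro integrable_lborel_compact_support[OF K(1)] continuous_intros continuous_on_subset[OF cw])
      (auto simp: D0)
  moreover show S: "integrable lborel S"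
  proof (rule integrable_lborel_compact_support[OF K(1)])
    show "continuous_on K S" unfolding S_def using p
      by (intro continuous_on_add continuous_on_mult continuous_on_const continuous_on_abs_powr
          continuous_on_monomial_weight cu P rad W V rad[OF cq]) auto
  qed (use u0 in \<open>auto simp: S_def\<close>)
  ultimately have "integrable lborel (\<lambda>x. (1 / p) * (D x * w x + S x))" by simp
  also have "(\<lambda>x. (1 / p) * (D x * w x + S x)) = T"
    using p by (auto simp: split fun_eq_iff)
  finally show T: "integrable lborel T" .
  show "p * (LINT x|lborel. T x) = (LINT x|lborel. S x)"
    using zero S T unfolding split by simp
qed

section \<open>The Hardy and Caffarelli-Kohn-Nirenberg inequalities\<close>

text \<open>The integrand of the identity is arranged for Hoelder's inequality: the weight \<open>v m\<close> is shared between
  the two factors as \<open>(v m)\<^sup>1\<^sup>/\<^sup>p (v m)\<^sup>(\<^sup>p\<^sup>-\<^sup>1\<^sup>)\<^sup>/\<^sup>p\<close>. Here \<open>a\<close>, \<open>d\<close>, \<open>y\<close>, \<open>e\<close> stand for the values of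
  \<open>u\<close>, \<open>\<partial>\<^sub>r u\<close>, \<open>\<phi>\<close>, \<open>\<phi>'\<close>.\<close>

lemma radial_flux_le_weighted_powr_product:
  fixes a d e m p v y :: real
  assumes p: "1 < p" and "0 \<le> v" "0 \<le> m" "0 < y"
  shows "\<bar>a\<bar> powr (p - 1) * sgn a * d * (v * \<bar>e\<bar> powr (p - 2) * e / y powr (p - 1)) * m
    \<le> (v * \<bar>d\<bar> powr p * m) powr (1 / p)
       * (\<bar>e / y\<bar> powr p * v * \<bar>a\<bar> powr p * m) powr ((p - 1) / p)"
proof -
  have split: "z powr (1 / p) * z powr ((p - 1) / p) = z" if "0 \<le> z" for z :: real
    using p that by (simp add: powr_add[symmetric] add_divide_distrib[symmetric])
  have root: "(\<bar>z\<bar> powr p) powr (1 / p) = \<bar>z\<bar>" 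
      "(\<bar>z\<bar> powr p) powr ((p - 1) / p) = \<bar>z\<bar> powr (p - 1)" for z :: real
    using p by (simp_all add: powr_powr)
  have e: "\<bar>e\<bar> powr (p - 2) * \<bar>e\<bar> = \<bar>e\<bar> powr (p - 1)"
    using powr_add[of "\<bar>e\<bar>" "p - 2" 1] by (cases "e = 0") auto
  have "\<bar>a\<bar> powr (p - 1) * sgn a * d * (v * \<bar>e\<bar> powr (p - 2) * e / y powr (p - 1)) * m
      \<le> \<bar>\<bar>a\<bar> powr (p - 1) * sgn a * d * (v * \<bar>e\<bar> powr (p - 2) * e / y powr (p - 1)) * m\<bar>"
    by (rule abs_ge_self)
  also have "\<dots> = \<bar>a\<bar> powr (p - 1) * \<bar>d\<bar> * (v * (\<bar>e\<bar> powr (p - 2) * \<bar>e\<bar>) / y powr (p - 1)) * m"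
    using assms by (auto simp: abs_mult abs_sgn_eq)
  also have "\<dots> = \<bar>d\<bar> * \<bar>a\<bar> powr (p - 1) * \<bar>e / y\<bar> powr (p - 1) * v * m"
    using assms unfolding e by (simp add: abs_divide powr_divide)
  also have "\<dots> = \<bar>d\<bar> * \<bar>a\<bar> powr (p - 1) * \<bar>e / y\<bar> powr (p - 1)
      * (v powr (1 / p) * v powr ((p - 1) / p)) * (m powr (1 / p) * m powr ((p - 1) / p))"
    using assms by (simp add: split)
  also have "\<dots> = (v * \<bar>d\<bar> powr p * m) powr (1 / p)
       * (\<bar>e / y\<bar> powr p * v * \<bar>a\<bar> powr p * m) powr ((p - 1) / p)"
    using assms by (simp only: powr_mult root powr_ge_zero mult_nonneg_nonneg) (simp only: mult_ac)
  finally show ?thesis .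
qed

text \<open>All four bounds for one solution and one test function. Hoelder's inequality gives the last one. The
  Hardy inequality \<open>H \<le> I2\<close> comes from the same integral by Young's inequality instead: there the
  terms \<open>(p - 1) J\<close> on both sides cancel.\<close>

lemma weighted_Hardy_integrals:
  fixes P :: "real ^ 'n"
  assumes p: "1 < p" and P: "\<forall>i. 0 \<le> P $ i"
    and V: "continuous_on (radii R) V" and W: "continuous_on (radii R) W"
    and V0: "\<forall>r\<in>radii R. 0 \<le> V r"
    and sol: "positive_solution p R (radial_weight P V) (radial_weight P W) \<phi>"
    and u: "u \<in> test_functions (B_star P R - {0})"
  defines "I1 \<equiv> LINT x:B_star P R|lborel. V (norm x) * norm (grad u x) powr p * monomial_weight P x"
    and "I2 \<equiv> LINT x:B_star P R|lborel.
             V (norm x) * \<bar>(x /\<^sub>R norm x) \<bullet> grad u x\<bar> powr p * monomial_weight P x"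
    and "J \<equiv> LINT x:B_star P R|lborel. \<bar>deriv \<phi> (norm x) / \<phi> (norm x)\<bar> powr p
               * V (norm x) * \<bar>u x\<bar> powr p * monomial_weight P x"
    and "H \<equiv> LINT x:B_star P R|lborel. W (norm x) * \<bar>u x\<bar> powr p * monomial_weight P x"
    and "S \<equiv> LINT x:B_star P R|lborel.
             (W (norm x) + (p - 1) * \<bar>deriv \<phi> (norm x) / \<phi> (norm x)\<bar> powr p * V (norm x))
               * \<bar>u x\<bar> powr p * monomial_weight P x"
  shows "0 \<le> I2" "I2 \<le> I1" "H \<le> I2" "1 / p * S \<le> I2 powr (1 / p) * J powr ((p - 1) / p)"
proof -
  define K where "K = closure {x. u x \<noteq> 0}"
  have K: "compact K" "K \<subseteq> B_star P R - {0}"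
    using u by (auto simp: K_def test_functions_def)
  have u0: "u x = 0" if "x \<notin> K" for x
    using that closure_subset[of "{x. u x \<noteq> 0}"] by (auto simp: K_def)
  have g0: "grad u x = 0" if "x \<notin> K" for x
    using that grad_eq_0_outside_support by (auto simp: K_def)
  define f1 where "f1 x = V (norm x) * norm (grad u x) powr p * monomial_weight P x" for x
  define f2 where "f2 x = V (norm x) * \<bar>(x /\<^sub>R norm x) \<bullet> grad u x\<bar> powr p * monomial_weight P x" for x
  define j where "j x = \<bar>deriv \<phi> (norm x) / \<phi> (norm x)\<bar> powr p
               * V (norm x) * \<bar>u x\<bar> powr p * monomial_weight P x" for x
  define k where "k x = W (norm x) * \<bar>u x\<bar> powr p * monomial_weight P x" for x
  define s where "s x = (W (norm x) + (p - 1) * \<bar>deriv \<phi> (norm x) / \<phi> (norm x)\<bar> powr p * V (norm x))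
               * \<bar>u x\<bar> powr p * monomial_weight P x" for x
  define T where "T x = \<bar>u x\<bar> powr (p - 1) * sgn (u x) * ((x /\<^sub>R norm x) \<bullet> grad u x)
      * (V (norm x) * \<bar>deriv \<phi> (norm x)\<bar> powr (p - 2) * deriv \<phi> (norm x) / \<phi> (norm x) powr (p - 1))
      * monomial_weight P x" for x
  have out: "f1 x = 0" "f2 x = 0" "j x = 0" "k x = 0" "s x = 0" "T x = 0" if "x \<notin> K" for x
    using that by (auto simp: f1_def f2_def j_def k_def s_def T_def u0 g0)
  have outB: "f1 x = 0" "f2 x = 0" "j x = 0" "k x = 0" "s x = 0" if "x \<notin> B_star P R" for x
    using that out[of x] K(2) by auto
  have whole: "I1 = (LINT x|lborel. f1 x)" "I2 = (LINT x|lborel. f2 x)" "J = (LINT x|lborel. j x)"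
      "H = (LINT x|lborel. k x)" "S = (LINT x|lborel. s x)"
    unfolding I1_def I2_def J_def H_def S_def f1_def[symmetric] f2_def[symmetric] j_def[symmetric]
      k_def[symmetric] s_def[symmetric]
    by (intro set_integral_eq_integral_of_support outB; assumption)+
  note identity = integral_Riccati_identity[OF p P V W sol u, folded s_def[abs_def] T_def[abs_def]]
  note rad = continuous_on_radial[OF _ K(2)]
  have cu: "continuous_on K u"
    using test_function_has_derivative_grad[OF u]
    by (meson continuous_at_imp_continuous_on has_derivative_continuous)
  have cgrad: "continuous_on K (grad u)"
    using test_function_continuous_grad[OF u] K(2) continuous_on_subset by blast
  have cdir: "continuous_on K (\<lambda>x. (x /\<^sub>R norm x) \<bullet> grad u x)"
    using K(2) by (intro continuous_intros cgrad) auto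
  have int1: "integrable lborel f1"
  proof (rule integrable_lborel_compact_support[OF K(1) _ out(1)])
    have "continuous_on K (\<lambda>x. \<bar>norm (grad u x)\<bar> powr p)"
      using p by (intro continuous_on_abs_powr continuous_on_norm cgrad) auto
    then show "continuous_on K f1" unfolding f1_def
      by (intro continuous_on_mult rad V continuous_on_monomial_weight P) simp
  qed
  have int2: "integrable lborel f2"
  proof (rule integrable_lborel_compact_support[OF K(1) _ out(2)])
    show "continuous_on K f2" unfolding f2_def using p
      by (intro continuous_on_mult rad V continuous_on_monomial_weight P continuous_on_abs_powr cdir) auto
  qed
  have intk: "integrable lborel k"
  proof (rule integrable_lborel_compact_support[OF K(1) _ out(4)])
    show "continuous_on K k" unfolding k_def using p
      by (intro continuous_on_mult rad W continuous_on_monomial_weight P continuous_on_abs_powr cu) auto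
  qed
  have s_split: "s x = k x + (p - 1) * j x" for x
    by (simp add: s_def k_def j_def algebra_simps)
  have "integrable lborel (\<lambda>x. (1 / (p - 1)) * (s x - k x))"
    using identity(2) intk by simp
  also have "(\<lambda>x. (1 / (p - 1)) * (s x - k x)) = j"
    using p by (simp add: s_split fun_eq_iff)
  finally have intj: "integrable lborel j" .
  have K_facts: "0 \<le> V (norm x)" "0 < \<phi> (norm x)" if "x \<in> K" for x
    using V0 positive_solution_facts(1)[OF sol] norm_in_radii[OF subsetD[OF K(2) that]] by simp_all
  have nonneg: "0 \<le> f2 x" "0 \<le> j x" for x
  proof -
    have "0 \<le> f2 x \<and> 0 \<le> j x"
    proof (cases "x \<in> K")
      case True
      show ?thesis unfolding f2_def j_def
        by (intro conjI mult_nonneg_nonneg K_facts(1) True monomial_weight_nonneg powr_ge_zero)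
    qed (simp add: out)
    then show "0 \<le> f2 x" "0 \<le> j x" by auto
  qed
  have "f2 x \<le> f1 x" for x
  proof (cases "x \<in> K")
    case True
    then have "x \<noteq> 0" using K(2) by auto
    then have "\<bar>(x /\<^sub>R norm x) \<bullet> grad u x\<bar> \<le> norm (grad u x)"
      using Cauchy_Schwarz_ineq2[of "x /\<^sub>R norm x" "grad u x"] by simp
    then show ?thesis
      unfolding f1_def f2_def using K_facts(1)[OF True] p
      by (intro mult_right_mono mult_left_mono powr_mono2 monomial_weight_nonneg) auto
  qed (simp add: out)
  then show "I2 \<le> I1"
    unfolding whole by (intro Bochner_Integration.integral_mono int1 int2)
  show "0 \<le> I2" unfolding whole by (intro Bochner_Integration.integral_nonneg nonneg)
  have T_le: "T x \<le> f2 x powr (1 / p) * j x powr ((p - 1) / p)" for x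
  proof (cases "x \<in> K")
    case True
    then show ?thesis
      unfolding T_def f2_def j_def
      using K_facts p by (intro radial_flux_le_weighted_powr_product monomial_weight_nonneg) auto
  qed (simp add: out)
  have amgm: "f2 x powr (1 / p) * j x powr ((p - 1) / p) \<le> 1 / p * f2 x + (p - 1) / p * j x" for x
    using p nonneg by (intro weighted_AM_GM) (auto simp: field_simps)
  have int_prod: "integrable lborel (\<lambda>x. f2 x powr (1 / p) * j x powr ((p - 1) / p))"
  proof (rule Bochner_Integration.integrable_bound)
    show "integrable lborel (\<lambda>x. 1 / p * f2 x + (p - 1) / p * j x)"
      using int2 intj by simp
    show "(\<lambda>x. f2 x powr (1 / p) * j x powr ((p - 1) / p)) \<in> borel_measurable lborel"
      using borel_measurable_integrable[OF int2] borel_measurable_integrable[OF intj] by measurable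
    show "AE x in lborel. norm (f2 x powr (1 / p) * j x powr ((p - 1) / p)) \<le> norm (1 / p * f2 x + (p - 1) / p * j x)"
      using amgm by (auto intro!: AE_I2 order_trans[OF _ abs_ge_self])
  qed
  have T_int: "1 / p * S = (LINT x|lborel. T x)"
    using identity(3) p by (simp add: whole field_simps)
  also have "\<dots> \<le> (LINT x|lborel. f2 x powr (1 / p) * j x powr ((p - 1) / p))"
    by (intro Bochner_Integration.integral_mono identity(1) int_prod T_le)
  finally have S_le: "1 / p * S \<le> (LINT x|lborel. f2 x powr (1 / p) * j x powr ((p - 1) / p))" .
  also have "\<dots> \<le> I2 powr (1 / p) * J powr ((p - 1) / p)"
    unfolding whole using p
    by (intro Holder_inequality_powr int2 intj nonneg) (auto simp: field_simps)
  finally show "1 / p * S \<le> I2 powr (1 / p) * J powr ((p - 1) / p)" .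
  have "1 / p * S \<le> (LINT x|lborel. 1 / p * f2 x + (p - 1) / p * j x)"
    using int2 intj
    by (intro order_trans[OF S_le] Bochner_Integration.integral_mono int_prod amgm) simp
  also have "\<dots> = 1 / p * I2 + (p - 1) / p * J"
    using int2 intj by (simp add: whole)
  also have "S = H + (p - 1) * J"
    using intk intj by (simp add: whole s_split)
  finally show "H \<le> I2" using p by (simp add: field_simps)
qed

theorem theorem1p7:
  fixes P :: "real ^ 'n"
    and p :: real and R :: ereal
    and V W :: "real \<Rightarrow> real"
  assumes "1 < p"
    and "0 < R"
    and "\<forall>i. 0 \<le> P $ i"
    and "smooth_on (radii R) V"
    and "smooth_on (radii R) W"
    and "\<forall>r\<in>radii R. 0 \<le> V r"
    and "p_Bessel_pair p R (radial_weight P V) (radial_weight P W)"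
  shows "(\<forall>u \<in> test_functions (B_star P R - {0}).
      (LINT x:B_star P R|lborel. V (norm x) * norm (grad u x) powr p * monomial_weight P x)
        \<ge> (LINT x:B_star P R|lborel.
             V (norm x) * \<bar>(x /\<^sub>R norm x) \<bullet> grad u x\<bar> powr p * monomial_weight P x)
      \<and> (LINT x:B_star P R|lborel.
             V (norm x) * \<bar>(x /\<^sub>R norm x) \<bullet> grad u x\<bar> powr p * monomial_weight P x)
        \<ge> (LINT x:B_star P R|lborel. W (norm x) * \<bar>u x\<bar> powr p * monomial_weight P x))
    \<and> (\<forall>\<phi>. positive_solution p R (radial_weight P V) (radial_weight P W) \<phi> \<longrightarrow>
      (\<forall>u \<in> test_functions (B_star P R - {0}).
        (LINT x:B_star P R|lborel.
             V (norm x) * norm (grad u x) powr p * monomial_weight P x) powr (1 / p)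
          * (LINT x:B_star P R|lborel. \<bar>deriv \<phi> (norm x) / \<phi> (norm x)\<bar> powr p
               * V (norm x) * \<bar>u x\<bar> powr p * monomial_weight P x) powr ((p - 1) / p)
        \<ge> (LINT x:B_star P R|lborel.
             V (norm x) * \<bar>(x /\<^sub>R norm x) \<bullet> grad u x\<bar> powr p * monomial_weight P x) powr (1 / p)
          * (LINT x:B_star P R|lborel. \<bar>deriv \<phi> (norm x) / \<phi> (norm x)\<bar> powr p
               * V (norm x) * \<bar>u x\<bar> powr p * monomial_weight P x) powr ((p - 1) / p)
      \<and> (LINT x:B_star P R|lborel.
             V (norm x) * \<bar>(x /\<^sub>R norm x) \<bullet> grad u x\<bar> powr p * monomial_weight P x) powr (1 / p)
          * (LINT x:B_star P R|lborel. \<bar>deriv \<phi> (norm x) / \<phi> (norm x)\<bar> powr p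
               * V (norm x) * \<bar>u x\<bar> powr p * monomial_weight P x) powr ((p - 1) / p)
        \<ge> 1 / p * (LINT x:B_star P R|lborel.
             (W (norm x) + (p - 1) * \<bar>deriv \<phi> (norm x) / \<phi> (norm x)\<bar> powr p * V (norm x))
               * \<bar>u x\<bar> powr p * monomial_weight P x)))"
proof -
  have V: "continuous_on (radii R) V" and W: "continuous_on (radii R) W"
    using assms(4,5) by (auto simp: smooth_on_def dest!: spec[of _ 0])
  note Hardy = weighted_Hardy_integrals[OF assms(1,3) V W assms(6)]
  obtain \<phi>0 where \<phi>0: "positive_solution p R (radial_weight P V) (radial_weight P W) \<phi>0"
    using assms(7) by (auto simp: p_Bessel_pair_def)
  show ?thesis
  proof (intro conjI ballI allI impI)
    fix u assume u: "u \<in> test_functions (B_star P R - {0})"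
    note Hardy(2,3)[OF \<phi>0 u]
    then show "(LINT x:B_star P R|lborel. V (norm x) * norm (grad u x) powr p * monomial_weight P x)
        \<ge> (LINT x:B_star P R|lborel.
             V (norm x) * \<bar>(x /\<^sub>R norm x) \<bullet> grad u x\<bar> powr p * monomial_weight P x)"
      "(LINT x:B_star P R|lborel.
             V (norm x) * \<bar>(x /\<^sub>R norm x) \<bullet> grad u x\<bar> powr p * monomial_weight P x)
        \<ge> (LINT x:B_star P R|lborel. W (norm x) * \<bar>u x\<bar> powr p * monomial_weight P x)"
      by blast+
  next
    fix \<phi> u assume \<phi>: "positive_solution p R (radial_weight P V) (radial_weight P W) \<phi>"
      and u: "u \<in> test_functions (B_star P R - {0})"
    note H = Hardy[OF \<phi> u]
    show "(LINT x:B_star P R|lborel.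
             V (norm x) * norm (grad u x) powr p * monomial_weight P x) powr (1 / p)
          * (LINT x:B_star P R|lborel. \<bar>deriv \<phi> (norm x) / \<phi> (norm x)\<bar> powr p
               * V (norm x) * \<bar>u x\<bar> powr p * monomial_weight P x) powr ((p - 1) / p)
        \<ge> (LINT x:B_star P R|lborel.
             V (norm x) * \<bar>(x /\<^sub>R norm x) \<bullet> grad u x\<bar> powr p * monomial_weight P x) powr (1 / p)
          * (LINT x:B_star P R|lborel. \<bar>deriv \<phi> (norm x) / \<phi> (norm x)\<bar> powr p
               * V (norm x) * \<bar>u x\<bar> powr p * monomial_weight P x) powr ((p - 1) / p)"
      using H(1,2) assms(1) by (intro mult_right_mono powr_mono2) auto
    show "(LINT x:B_star P R|lborel.
             V (norm x) * \<bar>(x /\<^sub>R norm x) \<bullet> grad u x\<bar> powr p * monomial_weight P x) powr (1 / p)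
          * (LINT x:B_star P R|lborel. \<bar>deriv \<phi> (norm x) / \<phi> (norm x)\<bar> powr p
               * V (norm x) * \<bar>u x\<bar> powr p * monomial_weight P x) powr ((p - 1) / p)
        \<ge> 1 / p * (LINT x:B_star P R|lborel.
             (W (norm x) + (p - 1) * \<bar>deriv \<phi> (norm x) / \<phi> (norm x)\<bar> powr p * V (norm x))
               * \<bar>u x\<bar> powr p * monomial_weight P x)"
      by (rule H(4))
  qed
qed

end
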